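(* Given two right-preordered groups $X$ and $Y$ with positive cones $P_X$ and $P_Y$, a group homomorphism $f\colon X\to Y$ is monotone if and only if $f(P_X)\subseteq P_Y$. Hence the category $\mathbf{ROrdGrp}$ of right-preordered groups and monotone group homomorphisms is isomorphic to the category whose objects are pairs $(X,M)$, where $X$ is a group and $M$ is a submonoid of $X$, and whose morphisms $f\colon (X,M)\to(Y,N)$ are the group homomorphisms $f\colon X\to Y$ that (co)restrict to $M\to N$ (i.e. $f(M)\subseteq N$).
   Context: Groups are written additively but need not be abelian. A right-preordered group is a group $X$ with a preorder (reflexive and transitive relation) $\leq$ such that $x\leq y$ implies $x+z\leq y+z$ for all $x,y,z\in X$. Its positive cone is $P_X=\{x\in X\mid x\geq 0\}$. *)

theory Defs
  imports "HOL-Algebra.Group" "HOL-Library.FuncSet"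
begin

section \<open>Right-preordered groups\<close>

text \<open>
  Groups are those of \<open>HOL-Algebra\<close>: carrier-based, not necessarily abelian, and written
  multiplicatively (the sum \<open>x + y\<close> is \<open>x \<otimes> y\<close>, and \<open>0\<close> is \<open>\<one>\<close>).
  The preorder \<open>x \<le> y\<close> is \<open>(x, y) \<in> r\<close>; \<^const>\<open>preorder_on\<close> includes
  \<open>r \<subseteq> carrier G \<times> carrier G\<close>.
\<close>

locale right_preordered_group = group G for G (structure) +
  fixes r :: "'a rel"
  assumes preorder: "preorder_on (carrier G) r"
    and right_translation:
      "\<lbrakk>x \<in> carrier G; y \<in> carrier G; z \<in> carrier G; (x, y) \<in> r\<rbrakk>
        \<Longrightarrow> (x \<otimes> z, y \<otimes> z) \<in> r"

definition positive_cone :: "'a monoid \<Rightarrow> 'a rel \<Rightarrow> 'a set" where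
  "positive_cone G r = {x \<in> carrier G. (\<one>\<^bsub>G\<^esub>, x) \<in> r}"

definition monotone_map :: "'a monoid \<Rightarrow> 'a rel \<Rightarrow> 'b rel \<Rightarrow> ('a \<Rightarrow> 'b) \<Rightarrow> bool" where
  "monotone_map G r s f \<longleftrightarrow>
     monotone_on (carrier G) (\<lambda>x y. (x, y) \<in> r) (\<lambda>x y. (x, y) \<in> s) f"


section \<open>Categories, functors, isomorphism of categories\<close>

text \<open>
  A category is given by its hom-sets. Hom-sets for different pairs of objects may overlap as
  HOL sets, so composition takes its three objects, and the arrow part of a functor its two
  objects, as arguments: \<open>comp\<^sub>C C A B D g f\<close> is the composite of \<open>f: A \<rightarrow> B\<close> and \<open>g: B \<rightarrow> D\<close>.
\<close>

record ('o, 'm) category_data =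
  obj :: "'o set"
  hom\<^sub>C :: "'o \<Rightarrow> 'o \<Rightarrow> 'm set"
  id\<^sub>C :: "'o \<Rightarrow> 'm"
  comp\<^sub>C :: "'o \<Rightarrow> 'o \<Rightarrow> 'o \<Rightarrow> 'm \<Rightarrow> 'm \<Rightarrow> 'm"

locale category =
  fixes C :: "('o, 'm) category_data"
  assumes id_closed: "A \<in> obj C \<Longrightarrow> id\<^sub>C C A \<in> hom\<^sub>C C A A"
    and comp_closed:
      "\<lbrakk>A \<in> obj C; B \<in> obj C; D \<in> obj C; f \<in> hom\<^sub>C C A B; g \<in> hom\<^sub>C C B D\<rbrakk>
        \<Longrightarrow> comp\<^sub>C C A B D g f \<in> hom\<^sub>C C A D"
    and comp_id_left:
      "\<lbrakk>A \<in> obj C; B \<in> obj C; f \<in> hom\<^sub>C C A B\<rbrakk>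
        \<Longrightarrow> comp\<^sub>C C A B B (id\<^sub>C C B) f = f"
    and comp_id_right:
      "\<lbrakk>A \<in> obj C; B \<in> obj C; f \<in> hom\<^sub>C C A B\<rbrakk>
        \<Longrightarrow> comp\<^sub>C C A A B f (id\<^sub>C C A) = f"
    and comp_assoc:
      "\<lbrakk>A \<in> obj C; B \<in> obj C; D \<in> obj C; E \<in> obj C;
        f \<in> hom\<^sub>C C A B; g \<in> hom\<^sub>C C B D; h \<in> hom\<^sub>C C D E\<rbrakk>
        \<Longrightarrow> comp\<^sub>C C A D E h (comp\<^sub>C C A B D g f)
            = comp\<^sub>C C A B E (comp\<^sub>C C B D E h g) f"

locale cat_functor = C: category C + D: category D
  for C :: "('o, 'm) category_data" and D :: "('p, 'n) category_data" +
  fixes Fo :: "'o \<Rightarrow> 'p" and Fa :: "'o \<Rightarrow> 'o \<Rightarrow> 'm \<Rightarrow> 'n"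
  assumes obj_closed: "A \<in> obj C \<Longrightarrow> Fo A \<in> obj D"
    and hom_closed:
      "\<lbrakk>A \<in> obj C; B \<in> obj C; f \<in> hom\<^sub>C C A B\<rbrakk>
        \<Longrightarrow> Fa A B f \<in> hom\<^sub>C D (Fo A) (Fo B)"
    and preserves_id: "A \<in> obj C \<Longrightarrow> Fa A A (id\<^sub>C C A) = id\<^sub>C D (Fo A)"
    and preserves_comp:
      "\<lbrakk>A \<in> obj C; B \<in> obj C; E \<in> obj C; f \<in> hom\<^sub>C C A B; g \<in> hom\<^sub>C C B E\<rbrakk>
        \<Longrightarrow> Fa A E (comp\<^sub>C C A B E g f)
            = comp\<^sub>C D (Fo A) (Fo B) (Fo E) (Fa B E g) (Fa A B f)"

definition isomorphic_categories ::
    "('o, 'm) category_data \<Rightarrow> ('p, 'n) category_data \<Rightarrow> bool" where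
  "isomorphic_categories C D \<longleftrightarrow>
     (\<exists>Fo Fa Go Ga. cat_functor C D Fo Fa \<and> cat_functor D C Go Ga \<and>
        (\<forall>A\<in>obj C. Go (Fo A) = A) \<and>
        (\<forall>A\<in>obj D. Fo (Go A) = A) \<and>
        (\<forall>A\<in>obj C. \<forall>B\<in>obj C. \<forall>f\<in>hom\<^sub>C C A B. Ga (Fo A) (Fo B) (Fa A B f) = f) \<and>
        (\<forall>A\<in>obj D. \<forall>B\<in>obj D. \<forall>f\<in>hom\<^sub>C D A B. Fa (Go A) (Go B) (Ga A B f) = f))"


section \<open>The two categories\<close>

text \<open>
  The type \<open>'a\<close> plays the role of the universe: the underlying set of every object is a subset
  of \<open>'a\<close>. So that equality in HOL is equality of groups and of maps, group operations are
  required to be \<^const>\<open>undefined\<close> off the carrier, and morphisms to be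
  \<^const>\<open>extensional\<close>.
\<close>

definition extensional_group :: "'a monoid \<Rightarrow> bool" where
  "extensional_group G \<longleftrightarrow> group G \<and>
     (\<forall>x y. \<not> (x \<in> carrier G \<and> y \<in> carrier G) \<longrightarrow> x \<otimes>\<^bsub>G\<^esub> y = undefined)"

definition ROrdGrp :: "('a monoid \<times> 'a rel, 'a \<Rightarrow> 'a) category_data" where
  "ROrdGrp =
     \<lparr>obj = {(X, r). extensional_group X \<and> right_preordered_group X r},
      hom\<^sub>C = (\<lambda>(X, r) (Y, s).
        {f \<in> hom X Y. f \<in> extensional (carrier X) \<and> monotone_map X r s f}),
      id\<^sub>C = (\<lambda>(X, r). \<lambda>x\<in>carrier X. x),
      comp\<^sub>C = (\<lambda>(X, r) _ _ g f. compose (carrier X) g f)\<rparr>"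

definition GrpSubmonoid :: "('a monoid \<times> 'a set, 'a \<Rightarrow> 'a) category_data" where
  "GrpSubmonoid =
     \<lparr>obj = {(X, M). extensional_group X \<and> submonoid M X},
      hom\<^sub>C = (\<lambda>(X, M) (Y, N).
        {f \<in> hom X Y. f \<in> extensional (carrier X) \<and> f ` M \<subseteq> N}),
      id\<^sub>C = (\<lambda>(X, M). \<lambda>x\<in>carrier X. x),
      comp\<^sub>C = (\<lambda>(X, M) _ _ g f. compose (carrier X) g f)\<rparr>"

end

theory Submission
  imports Defs
begin

text \<open>
  Translating by the inverse of \<open>x\<close> on the right shows that \<open>x \<le> y\<close> is equivalent to
  \<open>\<one> \<le> y \<otimes> inv x\<close>, so a right-invariant preorder is determined by its positive cone; and any
  submonoid \<open>M\<close> is the positive cone of the preorder \<open>y \<otimes> inv x \<in> M\<close>. These assignments are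
  mutually inverse, and they leave homomorphisms untouched.
\<close>

lemma (in right_preordered_group) rel_closed:
  assumes "(x, y) \<in> r"
  shows "x \<in> carrier G" "y \<in> carrier G"
  using assms preorder unfolding preorder_on_def by auto

lemma rel_iff_positive_cone:
  fixes G (structure)
  assumes "right_preordered_group G r" and [simp]: "x \<in> carrier G" "y \<in> carrier G"
  shows "(x, y) \<in> r \<longleftrightarrow> y \<otimes> inv x \<in> positive_cone G r"
proof -
  interpret right_preordered_group G r by fact
  show ?thesis
  proof
    assume "(x, y) \<in> r"
    then have "(x \<otimes> inv x, y \<otimes> inv x) \<in> r"
      by (intro right_translation) auto
    then show "y \<otimes> inv x \<in> positive_cone G r"
      by (simp add: positive_cone_def)
  next
    assume "y \<otimes> inv x \<in> positive_cone G r"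
    then have "(\<one> \<otimes> x, (y \<otimes> inv x) \<otimes> x) \<in> r"
      by (intro right_translation) (auto simp: positive_cone_def)
    then show "(x, y) \<in> r"
      by (simp add: m_assoc)
  qed
qed

lemma positive_cone_submonoid:
  fixes G (structure)
  assumes "right_preordered_group G r"
  shows "submonoid (positive_cone G r) G"
proof -
  interpret right_preordered_group G r by fact
  show ?thesis
  proof
    show "\<one> \<in> positive_cone G r"
      using preorder by (auto simp: positive_cone_def preorder_on_def refl_on_def)
  next
    fix x y assume x: "x \<in> positive_cone G r" and y: "y \<in> positive_cone G r"
    \<comment> \<open>Only translation on the right is available: applied to
      \<open>\<one> \<le> x\<close> it gives \<open>y \<le> x \<otimes> y\<close>, and
      \<open>\<one> \<le> y\<close> then closes the chain by transitivity.\<close>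
    then have "(\<one> \<otimes> y, x \<otimes> y) \<in> r"
      by (intro right_translation) (auto simp: positive_cone_def)
    then have "(\<one>, x \<otimes> y) \<in> r"
      using x y preorder by (auto simp: positive_cone_def preorder_on_def dest: transD)
    then show "x \<otimes> y \<in> positive_cone G r"
      using x y by (auto simp: positive_cone_def)
  qed (auto simp: positive_cone_def)
qed

text \<open>Forward, \<open>f\<close> fixes the unit, so monotonicity is applied to pairs whose
  smaller element is \<open>\<one>\<close>. Backward, \<open>f\<close> sends
  \<open>y \<otimes> inv x\<close> to \<open>f y \<otimes> inv (f x)\<close>, and membership of
  these elements in the cones decides both preorders.\<close>

lemma monotone_map_iff_positive_cone:
  assumes "right_preordered_group X r" "right_preordered_group Y s" and f: "f \<in> hom X Y"
  shows "monotone_map X r s f \<longleftrightarrow> f ` positive_cone X r \<subseteq> positive_cone Y s"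
proof -
  interpret X: right_preordered_group X r by fact
  interpret Y: right_preordered_group Y s by fact
  interpret group_hom X Y f by unfold_locales (rule f)
  show ?thesis
  proof
    assume "monotone_map X r s f"
    then have "(f \<one>\<^bsub>X\<^esub>, f x) \<in> s" if "x \<in> positive_cone X r" for x
      using that X.one_closed unfolding monotone_map_def monotone_on_def positive_cone_def by blast
    then show "f ` positive_cone X r \<subseteq> positive_cone Y s"
      by (auto simp: positive_cone_def)
  next
    assume cone: "f ` positive_cone X r \<subseteq> positive_cone Y s"
    have "(f x, f y) \<in> s" if "x \<in> carrier X" "y \<in> carrier X" "(x, y) \<in> r" for x y
    proof -
      have "f (y \<otimes>\<^bsub>X\<^esub> inv\<^bsub>X\<^esub> x) \<in> positive_cone Y s"
        using cone that rel_iff_positive_cone[OF assms(1)] by blast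
      then show ?thesis
        using that by (simp add: rel_iff_positive_cone[OF assms(2)])
    qed
    then show "monotone_map X r s f"
      by (auto simp: monotone_map_def monotone_on_def)
  qed
qed

text \<open>The inverse stands on the right of \<open>y\<close> so that a common right factor of
  \<open>x\<close> and \<open>y\<close> cancels, which gives invariance under right translation. The
  carrier conditions are there because \<open>preorder_on\<close> demands a relation inside the
  carrier.\<close>

definition submonoid_preorder :: "'a monoid \<Rightarrow> 'a set \<Rightarrow> 'a rel" where
  "submonoid_preorder G M =
     {(x, y). x \<in> carrier G \<and> y \<in> carrier G \<and> y \<otimes>\<^bsub>G\<^esub> inv\<^bsub>G\<^esub> x \<in> M}"

lemma right_preordered_group_submonoid_preorder:
  assumes "group G" "submonoid M G"
  shows "right_preordered_group G (submonoid_preorder G M)"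
proof -
  interpret group G by fact
  interpret M: submonoid M G by fact
  \<comment> \<open>Differences telescope: with closure of \<open>M\<close> under products this
    yields transitivity.\<close>
  have diff_trans: "(z \<otimes>\<^bsub>G\<^esub> inv\<^bsub>G\<^esub> y) \<otimes>\<^bsub>G\<^esub> (y \<otimes>\<^bsub>G\<^esub> inv\<^bsub>G\<^esub> x) = z \<otimes>\<^bsub>G\<^esub> inv\<^bsub>G\<^esub> x"
    if "x \<in> carrier G" "y \<in> carrier G" "z \<in> carrier G" for x y z
    using that by (simp add: m_assoc inv_solve_left')
  show ?thesis
  proof
    show "preorder_on (carrier G) (submonoid_preorder G M)"
      unfolding preorder_on_def
    proof (intro conjI)
      show "trans (submonoid_preorder G M)"
      proof (rule transI)
        fix x y z
        assume "(x, y) \<in> submonoid_preorder G M" "(y, z) \<in> submonoid_preorder G M"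
        then show "(x, z) \<in> submonoid_preorder G M"
          using M.m_closed[of "z \<otimes>\<^bsub>G\<^esub> inv\<^bsub>G\<^esub> y" "y \<otimes>\<^bsub>G\<^esub> inv\<^bsub>G\<^esub> x"]
          by (simp add: submonoid_preorder_def diff_trans)
      qed
    qed (auto simp: submonoid_preorder_def refl_on_def)
  next
    fix x y z
    assume xyz: "x \<in> carrier G" "y \<in> carrier G" "z \<in> carrier G"
      and "(x, y) \<in> submonoid_preorder G M"
    \<comment> \<open>The same telescoping with middle element \<open>inv z\<close>: its two factors
      are \<open>y \<otimes> z\<close> and \<open>inv z \<otimes> inv x\<close>, the latter being
      \<open>inv (x \<otimes> z)\<close>.\<close>
    moreover have "(y \<otimes>\<^bsub>G\<^esub> z) \<otimes>\<^bsub>G\<^esub> inv\<^bsub>G\<^esub> (x \<otimes>\<^bsub>G\<^esub> z) = y \<otimes>\<^bsub>G\<^esub> inv\<^bsub>G\<^esub> x"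
      using xyz diff_trans[of x "inv\<^bsub>G\<^esub> z" y] by (simp add: inv_mult_group)
    ultimately show "(x \<otimes>\<^bsub>G\<^esub> z, y \<otimes>\<^bsub>G\<^esub> z) \<in> submonoid_preorder G M"
      by (simp add: submonoid_preorder_def)
  qed
qed

lemma positive_cone_submonoid_preorder:
  assumes "group G" "submonoid M G"
  shows "positive_cone G (submonoid_preorder G M) = M"
proof -
  interpret group G by fact
  interpret M: submonoid M G by fact
  show ?thesis
    using M.subset by (auto simp: positive_cone_def submonoid_preorder_def)
qed

text \<open>On the carrier this is \<open>rel_iff_positive_cone\<close>; pairs outside it lie in
  neither relation, by \<open>rel_closed\<close>.\<close>

lemma submonoid_preorder_positive_cone:
  assumes "right_preordered_group G r"
  shows "submonoid_preorder G (positive_cone G r) = r"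
proof (rule Set.set_eqI)
  fix p :: "'a \<times> 'a"
  obtain x y where p: "p = (x, y)" by (cases p)
  have "(x, y) \<in> submonoid_preorder G (positive_cone G r)
      \<longleftrightarrow> x \<in> carrier G \<and> y \<in> carrier G \<and> (x, y) \<in> r"
    using rel_iff_positive_cone[OF assms]
    by (auto simp only: submonoid_preorder_def mem_Collect_eq case_prod_conv)
  then show "p \<in> submonoid_preorder G (positive_cone G r) \<longleftrightarrow> p \<in> r"
    using right_preordered_group.rel_closed[OF assms] p by blast
qed

lemma extensional_groupD: "extensional_group G \<Longrightarrow> group G"
  by (simp add: extensional_group_def)

lemma restrict_id_hom:
  "group G \<Longrightarrow> (\<lambda>x\<in>carrier G. x) \<in> hom G G"
  by (auto simp: hom_def group.is_monoid monoid.m_closed)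

lemma category_GrpSubmonoid: "category GrpSubmonoid"
proof
  show "\<And>A. A \<in> obj GrpSubmonoid \<Longrightarrow> id\<^sub>C GrpSubmonoid A \<in> hom\<^sub>C GrpSubmonoid A A"
    \<comment> \<open>The restricted identity fixes only carrier elements, so it maps
      \<open>M\<close> into \<open>M\<close> because \<open>M\<close> lies inside the
      carrier.\<close>
    using submonoid.subset
    by (fastforce simp: GrpSubmonoid_def intro: restrict_id_hom extensional_groupD)
next
  fix A B D f g
  assume "f \<in> hom\<^sub>C GrpSubmonoid A B" "g \<in> hom\<^sub>C GrpSubmonoid B D" "A \<in> obj GrpSubmonoid"
  then show "comp\<^sub>C GrpSubmonoid A B D g f \<in> hom\<^sub>C GrpSubmonoid A D"
    using submonoid.subset extensional_groupD
    by (auto simp: GrpSubmonoid_def compose_eq group.hom_compose image_subset_iff subset_eq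
        intro!: group.hom_compose)
\<comment> \<open>The unit and associativity laws are equalities of functions: on the carrier they
  hold because homomorphisms land in the next carrier, and off it both sides are
  \<open>undefined\<close> by extensionality.\<close>
qed (auto simp: GrpSubmonoid_def hom_def compose_def extensional_def fun_eq_iff)

text \<open>The cone criterion makes the hom-sets literally equal, so both functors can be the
  identity on arrows.\<close>

lemma hom_ROrdGrp_eq:
  assumes "(X, r) \<in> obj ROrdGrp" "(Y, s) \<in> obj ROrdGrp"
  shows "hom\<^sub>C ROrdGrp (X, r) (Y, s)
    = hom\<^sub>C GrpSubmonoid (X, positive_cone X r) (Y, positive_cone Y s)"
  using assms monotone_map_iff_positive_cone[of X r Y s]
  by (auto simp: ROrdGrp_def GrpSubmonoid_def)

lemma category_ROrdGrp: "category ROrdGrp"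
proof
  show "\<And>A. A \<in> obj ROrdGrp \<Longrightarrow> id\<^sub>C ROrdGrp A \<in> hom\<^sub>C ROrdGrp A A"
    by (auto simp: ROrdGrp_def monotone_map_def monotone_on_def
        intro: restrict_id_hom extensional_groupD)
next
  fix A B D f g
  assume "f \<in> hom\<^sub>C ROrdGrp A B" "g \<in> hom\<^sub>C ROrdGrp B D" "A \<in> obj ROrdGrp"
  then show "comp\<^sub>C ROrdGrp A B D g f \<in> hom\<^sub>C ROrdGrp A D"
    by (auto simp: ROrdGrp_def compose_eq monotone_map_def monotone_on_def hom_in_carrier
        intro!: group.hom_compose extensional_groupD)
qed (auto simp: ROrdGrp_def hom_def compose_def extensional_def fun_eq_iff)

lemma isomorphic_categories_ROrdGrp_GrpSubmonoid:
  "isomorphic_categories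
    (ROrdGrp :: ('a monoid \<times> 'a rel, 'a \<Rightarrow> 'a) category_data)
    (GrpSubmonoid :: ('a monoid \<times> 'a set, 'a \<Rightarrow> 'a) category_data)"
proof -
  let ?F = "\<lambda>(X :: 'a monoid, r). (X, positive_cone X r)"
  let ?G = "\<lambda>(X :: 'a monoid, M). (X, submonoid_preorder X M)"
  have F_obj: "?F A \<in> obj GrpSubmonoid" if "A \<in> obj ROrdGrp" for A
    using that positive_cone_submonoid
    by (auto simp: ROrdGrp_def GrpSubmonoid_def)
  have G_obj: "?G A \<in> obj ROrdGrp" if "A \<in> obj GrpSubmonoid" for A
    using that right_preordered_group_submonoid_preorder extensional_groupD
    by (auto simp: ROrdGrp_def GrpSubmonoid_def)
  have GF: "?G (?F A) = A" if "A \<in> obj ROrdGrp" for A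
    using that submonoid_preorder_positive_cone
    by (auto simp: ROrdGrp_def)
  have FG: "?F (?G A) = A" if "A \<in> obj GrpSubmonoid" for A
    using that positive_cone_submonoid_preorder extensional_groupD
    by (auto simp: GrpSubmonoid_def)
  have hom_F: "hom\<^sub>C GrpSubmonoid (?F A) (?F B) = hom\<^sub>C ROrdGrp A B"
    if "A \<in> obj ROrdGrp" "B \<in> obj ROrdGrp" for A B
    using that by (cases A; cases B) (simp add: hom_ROrdGrp_eq)
  \<comment> \<open>No second computation is needed: \<open>hom_F\<close> at the objects
    \<open>?G A\<close> and \<open>?G B\<close> gives this once \<open>FG\<close> rewrites
    \<open>?F (?G A)\<close> to \<open>A\<close>.\<close>
  have hom_G: "hom\<^sub>C ROrdGrp (?G A) (?G B) = hom\<^sub>C GrpSubmonoid A B"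
    if "A \<in> obj GrpSubmonoid" "B \<in> obj GrpSubmonoid" for A B
    using hom_F[OF G_obj[OF that(1)] G_obj[OF that(2)]] FG that by simp
  \<comment> \<open>Identities and composites in both categories depend only on the group component,
    which \<open>?F\<close> and \<open>?G\<close> leave unchanged, so both are preserved by
    definition.\<close>
  have "cat_functor ROrdGrp GrpSubmonoid ?F (\<lambda>_ _ f. f)"
    by (intro cat_functor.intro cat_functor_axioms.intro category_ROrdGrp category_GrpSubmonoid)
      (use F_obj hom_F in \<open>auto simp: ROrdGrp_def GrpSubmonoid_def\<close>)
  moreover have "cat_functor GrpSubmonoid ROrdGrp ?G (\<lambda>_ _ f. f)"
    by (intro cat_functor.intro cat_functor_axioms.intro category_ROrdGrp category_GrpSubmonoid)
      (use G_obj hom_G in \<open>auto simp: ROrdGrp_def GrpSubmonoid_def\<close>)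
  ultimately show ?thesis
    unfolding isomorphic_categories_def
    by - (rule exI[of _ ?F], rule exI[of _ "\<lambda>_ _ f. f"],
        rule exI[of _ ?G], rule exI[of _ "\<lambda>_ _ f. f"], simp add: GF FG)
qed

theorem mainTheorem5:
  shows "(\<forall>(X :: 'a monoid) r (Y :: 'b monoid) s f.
            right_preordered_group X r \<longrightarrow> right_preordered_group Y s \<longrightarrow> f \<in> hom X Y \<longrightarrow>
              (monotone_map X r s f \<longleftrightarrow> f ` positive_cone X r \<subseteq> positive_cone Y s))
       \<and> isomorphic_categories
            (ROrdGrp :: ('c monoid \<times> 'c rel, 'c \<Rightarrow> 'c) category_data)
            (GrpSubmonoid :: ('c monoid \<times> 'c set, 'c \<Rightarrow> 'c) category_data)"
  using monotone_map_iff_positive_cone isomorphic_categories_ROrdGrp_GrpSubmonoid by blast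

end
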